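(* For every integer $N\ge 4$, there are at least $\frac{1}{3!}(N-1)!$ pairwise non-normally-equivalent indecomposable deformed $N$-permutahedra which are not normally equivalent to matroid polytopes.
   Context: A polytope $\mathsf Q$ is a deformation (weak Minkowski summand) of a polytope $\mathsf P$ if $\lambda\mathsf P=\mathsf Q+\mathsf R$ for some $\lambda>0$ and some polytope $\mathsf R$. A polytope $\mathsf P$ is indecomposable if its only deformations are $\lambda\mathsf P+t$ with $\lambda\ge0$ and $t$ a vector. The $N$-permutahedron $\mathsf\Pi_N\subset\mathbb R^N$ is the convex hull of the $N!$ permutations of the vector $(1,2,\dots,N)$; a deformed $N$-permutahedron is a deformation of $\mathsf\Pi_N$ (equivalently, a polytope in $\mathbb R^N$ all of whose edges are parallel to $e_i-e_j$ for some $i,j\in[N]$). Two polytopes are normally equivalent if they have the same normal fan. The matroid polytope of a matroid $M$ on ground set $[N]$ is $\mathrm{conv}\{\sum_{x\in B}e_x : B\text{ a basis of }M\}\subset\mathbb R^N$. *)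

theory Defs
  imports "HOL-Analysis.Analysis"
begin

(* The sum of two sets is the Minkowski sum of HOL-Library.Set_Algebras. *)
definition deformation :: "'a::euclidean_space set \<Rightarrow> 'a set \<Rightarrow> bool" where
  "deformation Q P \<longleftrightarrow>
     polytope Q \<and> (\<exists>l>0. \<exists>R. polytope R \<and> (\<lambda>x. l *\<^sub>R x) ` P = Q + R)"

(* The library's polytopes include the empty set, but the empty set is not indecomposable:
   {} = Q + {} makes every polytope Q one of its deformations. Single points, on the other hand,
   are indecomposable. *)
definition indecomposable :: "'a::euclidean_space set \<Rightarrow> bool" where
  "indecomposable P \<longleftrightarrow>
     polytope P \<and>
     (\<forall>Q. deformation Q P \<longrightarrow> (\<exists>l\<ge>0. \<exists>t. Q = (\<lambda>x. l *\<^sub>R x + t) ` P))"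

definition normal_cone :: "'a::euclidean_space set \<Rightarrow> 'a set \<Rightarrow> 'a set" where
  "normal_cone P F = {c. \<forall>x\<in>F. \<forall>y\<in>P. c \<bullet> y \<le> c \<bullet> x}"

definition normal_fan :: "'a::euclidean_space set \<Rightarrow> 'a set set" where
  "normal_fan P = {normal_cone P F | F. F face_of P \<and> F \<noteq> {}}"

definition normally_equivalent :: "'a::euclidean_space set \<Rightarrow> 'a set \<Rightarrow> bool" where
  "normally_equivalent P Q \<longleftrightarrow> normal_fan P = normal_fan Q"

(* The index type 'n plays the role of {1,...,N}, with N = CARD('n). *)
definition permutahedron :: "(real^'n::finite) set" where
  "permutahedron = convex hull {\<chi> i. real (\<sigma> i) | \<sigma>. bij_betw \<sigma> UNIV {1..CARD('n)}}"

definition deformed_permutahedron :: "(real^'n::finite) set \<Rightarrow> bool" where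
  "deformed_permutahedron P \<longleftrightarrow> deformation P permutahedron"

(* A matroid on the ground set UNIV, given by its set of bases. *)
definition matroid_bases :: "'n::finite set set \<Rightarrow> bool" where
  "matroid_bases \<B> \<longleftrightarrow>
     \<B> \<noteq> {} \<and>
     (\<forall>A\<in>\<B>. \<forall>B\<in>\<B>. \<forall>a\<in>A - B. \<exists>b\<in>B - A. insert b (A - {a}) \<in> \<B>)"

definition matroid_polytope :: "'n::finite set set \<Rightarrow> (real^'n) set" where
  "matroid_polytope \<B> = convex hull {\<Sum>x\<in>B. axis x 1 | B. B \<in> \<B>}"

end

theory Submission
  imports Defs
begin

text \<open>For weights \<open>u\<close> on the ground set and a threshold \<open>k\<close>, the base polytope of
  \<open>f A = min k (\<Sum>i\<in>A. u i)\<close> is a deformed permutahedron, since a large multiple of the strictly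
  submodular rank function of the permutahedron minus \<open>f\<close> is still submodular. The support function
  of a deformation (or of a polytope with the same normal fan) is modular wherever \<open>f\<close> is. Give one
  element \<open>z\<close> the weight \<open>k\<close>. If the sets of weight \<open>k\<close> determine the other weights up to scaling,
  then every such set function is \<open>c f\<close> plus a modular function. This gives indecomposability, it
  shows that the weights can be recovered from the normal fan, and it excludes matroid polytopes,
  because \<open>f\<close> has three different increments along \<open>z\<close>.

  The weights on the other \<open>N - 1\<close> elements are 1, 1, 1, 2, 3, \<dots>, \<open>N - 3\<close> in any of the
  \<open>(N - 1)! / 3!\<close> arrangements. A suitable \<open>k\<close> is found by induction: a new weight \<open>t\<close> preserves
  rigidity with the same threshold if \<open>k - t\<close> is the weight of some set, and with the threshold
  \<open>k + t\<close> if \<open>k + t\<close> is the weight of some set of old elements; one of the two always applies.\<close>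

section \<open>Rigid thresholds\<close>

text \<open>The common value \<open>K\<close> is not prescribed. This lets the shifting step below
  replace it by \<open>K - w j\<close>.\<close>

definition threshold_rigid :: "'a set \<Rightarrow> ('a \<Rightarrow> nat) \<Rightarrow> nat \<Rightarrow> bool" where
  "threshold_rigid S u k \<longleftrightarrow>
     (\<forall>(w :: 'a \<Rightarrow> real) K. (\<forall>A\<subseteq>S. sum u A = k \<longrightarrow> sum w A = K) \<longrightarrow>
        (\<exists>c. \<forall>i\<in>S. w i = c * real (u i)))"

lemma sum_scaled_weights:
  fixes w :: "'a \<Rightarrow> real" and u :: "'a \<Rightarrow> nat"
  assumes "\<And>i. i \<in> A \<Longrightarrow> w i = c * real (u i)"
  shows "sum w A = c * real (sum u A)"
  using assms by (simp add: sum_distrib_left)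

text \<open>The sets inside \<open>S\<close> already force \<open>w\<close> to be
  \<open>c * u\<close> there, and \<open>A0\<close> identifies the common value as
  \<open>c * k\<close>. Completing \<open>B\<close> by \<open>j\<close> to weight \<open>k\<close>
  then leaves only one possible value for \<open>w j\<close>.\<close>

lemma threshold_rigid_insert_same:
  assumes "threshold_rigid S u k" "finite S" "j \<notin> S"
    and A0: "A0 \<subseteq> S" "sum u A0 = k"
    and B: "B \<subseteq> S" "sum u B + u j = k"
  shows "threshold_rigid (insert j S) u k"
  unfolding threshold_rigid_def
proof (intro allI impI)
  fix w :: "'a \<Rightarrow> real" and K
  assume w: "\<forall>A\<subseteq>insert j S. sum u A = k \<longrightarrow> sum w A = K"
  then obtain c where c: "\<forall>i\<in>S. w i = c * real (u i)"
    using assms(1) unfolding threshold_rigid_def by (metis subset_insertI2)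
  have "K = c * real k"
    using w A0 sum_scaled_weights[of A0 w c u] c by (metis subset_insertI2 subsetD)
  moreover have "j \<notin> B" "finite B"
    using B assms(2,3) finite_subset by auto
  then have "K = w j + sum w B"
    using w B by (metis add.commute insert_mono sum.insert)
  moreover have "sum w B = c * real (sum u B)"
    using sum_scaled_weights c B(1) by (metis subsetD)
  ultimately have "w j = c * real (u j)"
    unfolding B(2)[symmetric] by (simp add: distrib_left)
  with c show "\<exists>c. \<forall>i\<in>insert j S. w i = c * real (u i)"
    by auto
qed

text \<open>Adding \<open>j\<close> to the old sets of weight \<open>k\<close> shows that
  \<open>w\<close> has the constant sum \<open>K - w j\<close> on them, so rigidity applies on
  \<open>S\<close>. The set \<open>B\<close>, which avoids \<open>j\<close>, expresses
  \<open>K\<close> a second time; comparison with \<open>A0\<close> isolates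
  \<open>w j\<close>.\<close>

lemma threshold_rigid_insert_shift:
  assumes "threshold_rigid S u k" "finite S" "j \<notin> S"
    and A0: "A0 \<subseteq> S" "sum u A0 = k"
    and B: "B \<subseteq> S" "sum u B = k + u j"
  shows "threshold_rigid (insert j S) u (k + u j)"
  unfolding threshold_rigid_def
proof (intro allI impI)
  fix w :: "'a \<Rightarrow> real" and K
  assume w: "\<forall>A\<subseteq>insert j S. sum u A = k + u j \<longrightarrow> sum w A = K"
  have w': "sum w A = K - w j" if "A \<subseteq> S" "sum u A = k" for A
  proof -
    have "j \<notin> A" "finite A"
      using that assms(2,3) finite_subset by auto
    then show ?thesis
      using w[rule_format, of "insert j A"] that by (auto simp: subset_insertI2)
  qed
  then obtain c where c: "\<forall>i\<in>S. w i = c * real (u i)"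
    using assms(1) unfolding threshold_rigid_def by metis
  have "K - w j = c * real k"
    using w' A0 sum_scaled_weights[of A0 w c u] c by (metis subsetD)
  moreover have "K = c * real (k + u j)"
    using w B sum_scaled_weights[of B w c u] c by (metis subset_insertI2 subsetD)
  ultimately have "w j = c * real (u j)"
    by (simp add: algebra_simps)
  with c show "\<exists>c. \<forall>i\<in>insert j S. w i = c * real (u i)"
    by auto
qed

text \<open>Besides the threshold, the induction carries two facts: all numbers up to the total are
  subset sums, which supplies the sets \<open>A0\<close> and \<open>B\<close> for both extension
  lemmas, and the total is large enough for a shifted threshold to stay in range.\<close>

lemma exists_rigid_threshold:
  assumes "distinct [a, b, c]" "u a = 1" "u b = 1" "u c = 1"
    and "distinct xs" "set xs \<inter> {a, b, c} = {}"
    and "\<And>j. j < length xs \<Longrightarrow> u (xs ! j) = j + 2"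
  defines "S \<equiv> \<lambda>xs. {a, b, c} \<union> set xs"
  shows "2 * length xs + 3 \<le> sum u (S xs) \<and>
    (\<forall>s\<le>sum u (S xs). \<exists>B\<subseteq>S xs. sum u B = s) \<and>
    (\<exists>k\<ge>2. k \<le> sum u (S xs) \<and> (\<forall>i\<in>S xs. u i \<le> k) \<and> threshold_rigid (S xs) u k)"
  using assms(5-7)
proof (induction xs rule: rev_induct)
  case Nil
  have abc: "a \<noteq> b" "a \<noteq> c" "b \<noteq> c"
    using assms(1) by auto
  then have S: "sum u (S []) = 3"
    using assms(2-4) by (simp add: S_def)
  have "\<exists>B\<subseteq>S []. sum u B = s" if s: "s \<le> 3" for s
  proof -
    consider "s = 0" | "s = 1" | "s = 2" | "s = 3"
      using s by linarith
    then show ?thesis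
    proof cases
      case 1 then show ?thesis by (intro exI[of _ "{}"]) auto
    next
      case 2 then show ?thesis using assms(2) by (intro exI[of _ "{a}"]) (auto simp: S_def)
    next
      case 3 then show ?thesis using assms(2,3) abc by (intro exI[of _ "{a, b}"]) (auto simp: S_def)
    next
      case 4 then show ?thesis using S by blast
    qed
  qed
  \<comment> \<open>Any two of the three unit weights sum to 2, so equal pair sums force equal
    values of \<open>w\<close>.\<close>
  moreover have "threshold_rigid (S []) u 2"
    unfolding threshold_rigid_def
  proof (intro allI impI)
    fix w :: "'a \<Rightarrow> real" and K
    assume w: "\<forall>A\<subseteq>S []. sum u A = 2 \<longrightarrow> sum w A = K"
    have "w a + w b = K" "w a + w c = K" "w b + w c = K"
      using w[rule_format, of "{a, b}"] w[rule_format, of "{a, c}"] w[rule_format, of "{b, c}"]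
        abc assms(2-4) by (auto simp: S_def)
    then have "w b = w a" "w c = w a"
      by auto
    then show "\<exists>c. \<forall>i\<in>S []. w i = c * real (u i)"
      using assms(2-4) by (intro exI[of _ "w a"]) (auto simp: S_def)
  qed
  ultimately show ?case
    using S assms(2-4) by (auto simp: S_def intro!: exI[of _ 2])
next
  case (snoc x xs)
  let ?T = "sum u (S xs)" and ?t = "length xs + 2"
  have ux: "u x = ?t"
    using snoc.prems(3)[of "length xs"] by simp
  have "u (xs ! j) = j + 2" if "j < length xs" for j
    using snoc.prems(3)[of j] that by (simp add: nth_append)
  with snoc have IH: "2 * length xs + 3 \<le> ?T" "\<And>s. s \<le> ?T \<Longrightarrow> \<exists>B\<subseteq>S xs. sum u B = s"
    and "\<exists>k\<ge>2. k \<le> ?T \<and> (\<forall>i\<in>S xs. u i \<le> k) \<and> threshold_rigid (S xs) u k"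
    by auto
  then obtain k where k: "k \<ge> 2" "k \<le> ?T" "\<forall>i\<in>S xs. u i \<le> k" "threshold_rigid (S xs) u k"
    by auto
  have Sx: "S (xs @ [x]) = insert x (S xs)" and xS: "x \<notin> S xs" and fin: "finite (S xs)"
    using snoc.prems(1,2) by (auto simp: S_def)
  have tot: "sum u (S (xs @ [x])) = ?T + ?t"
    using Sx xS fin ux by simp
  have "\<exists>B\<subseteq>S (xs @ [x]). sum u B = s" if "s \<le> ?T + ?t" for s
  proof (cases "s \<le> ?T")
    case True
    then show ?thesis using IH(2) Sx by (metis subset_insertI2)
  next
    case False
    \<comment> \<open>The second inequality holds because \<open>?t\<close> is at most
      \<open>2 * length xs + 3\<close>, hence at most \<open>?T\<close>, which is below
      \<open>s\<close>.\<close>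
    then have "s - ?t \<le> ?T" "?t \<le> s"
      using IH(1) that by auto
    then obtain B where B: "B \<subseteq> S xs" "sum u B = s - ?t"
      using IH(2) by blast
    then have "x \<notin> B" "finite B"
      using xS fin finite_subset by auto
    with B \<open>?t \<le> s\<close> show ?thesis
      using Sx ux by (intro exI[of _ "insert x B"]) auto
  qed
  moreover obtain A0 where A0: "A0 \<subseteq> S xs" "sum u A0 = k"
    using IH(2) k(2) by blast
  have "\<exists>k\<ge>2. k \<le> sum u (S (xs @ [x])) \<and> (\<forall>i\<in>S (xs @ [x]). u i \<le> k) \<and>
      threshold_rigid (S (xs @ [x])) u k"
  proof (cases "?t \<le> k")
    case True
    then obtain B where "B \<subseteq> S xs" "sum u B = k - ?t"
      using IH(2)[of "k - ?t"] k(2) by (meson diff_le_self order_trans)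
    then have "threshold_rigid (S (xs @ [x])) u k"
      using threshold_rigid_insert_same[OF k(4) fin xS A0, of B] True Sx ux by simp
    then show ?thesis
      using k True tot Sx ux by (intro exI[of _ k]) auto
  next
    case False
    \<comment> \<open>Here \<open>k\<close> is at most \<open>length xs + 1\<close>, so
      \<open>k + ?t\<close> is at most \<open>2 * length xs + 3\<close>, exactly the lower bound on
      the total that the induction carries.\<close>
    then have le: "k + ?t \<le> ?T"
      using IH(1) by linarith
    then obtain B where "B \<subseteq> S xs" "sum u B = k + ?t"
      using IH(2) by blast
    then have "threshold_rigid (S (xs @ [x])) u (k + ?t)"
      using threshold_rigid_insert_shift[OF k(4) fin xS A0, of B] Sx ux by simp
    then show ?thesis
      using k le tot Sx ux by (intro exI[of _ "k + ?t"]) (auto intro: trans_le_add1)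
  qed
  ultimately show ?case
    using tot IH(1) by auto
qed

section \<open>Truncated weight functions and their rigidity\<close>

definition threshold_rank :: "nat \<Rightarrow> ('a \<Rightarrow> nat) \<Rightarrow> 'a set \<Rightarrow> real" where
  "threshold_rank k u A = real (min k (sum u A))"

text \<open>The weight is modular and monotone, and truncation at \<open>k\<close> is
  concave.\<close>

lemma threshold_rank_submodular:
  fixes u :: "'a::finite \<Rightarrow> nat"
  shows "threshold_rank k u (A \<inter> B) + threshold_rank k u (A \<union> B)
    \<le> threshold_rank k u A + threshold_rank k u B"
proof -
  have "sum u (A \<union> B) + sum u (A \<inter> B) = sum u A + sum u B"
    by (simp add: sum.union_inter)
  moreover have "sum u (A \<inter> B) \<le> sum u A" "sum u (A \<inter> B) \<le> sum u B"
    by (auto intro: sum_mono2)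
  ultimately have "min k (sum u (A \<inter> B)) + min k (sum u (A \<union> B)) \<le> min k (sum u A) + min k (sum u B)"
    by linarith
  then show ?thesis
    unfolding threshold_rank_def by linarith
qed

text \<open>Modular functions lie in every cone of tight set functions, so h is first normalised to be
  constant on the sets of weight at least k; rigidity of the threshold then applies to its values
  on singletons.\<close>

lemma threshold_rank_rigid:
  fixes u :: "'a::finite \<Rightarrow> nat" and h :: "'a set \<Rightarrow> real"
  assumes uz: "u z = k" and large: "k \<le> sum u (- {z})"
    and A0: "A0 \<subseteq> - {z}" "sum u A0 = k"
    and rigid: "threshold_rigid (- {z}) u k"
    and h0: "h {} = 0"
    and tight: "\<And>A B. threshold_rank k u A + threshold_rank k u B
        = threshold_rank k u (A \<inter> B) + threshold_rank k u (A \<union> B)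
      \<Longrightarrow> h A + h B = h (A \<inter> B) + h (A \<union> B)"
  shows "\<exists>c m. \<forall>A. h A = c * threshold_rank k u A + sum m A"
proof -
  \<comment> \<open>All four sets involved weigh at least \<open>k\<close>, so the truncated weight
    equals \<open>k\<close> on each of them.\<close>
  have big: "h A + h B = h (A \<inter> B) + h (A \<union> B)" if "k \<le> sum u (A \<inter> B)" for A B
  proof (rule tight)
    have "sum u (A \<inter> B) \<le> sum u A" "sum u (A \<inter> B) \<le> sum u B" "sum u A \<le> sum u (A \<union> B)"
      by (auto intro: sum_mono2)
    then show "threshold_rank k u A + threshold_rank k u B
        = threshold_rank k u (A \<inter> B) + threshold_rank k u (A \<union> B)"
      using that by (simp add: threshold_rank_def)
  qed
  have kz: "k \<le> sum u A" if "z \<in> A" for A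
    using uz that member_le_sum[of z A u] by auto
  \<comment> \<open>\<open>K\<close> solves the equation
    \<open>h (- {z}) = K + sum m (- {z})\<close>, and the value of \<open>m\<close> at
    \<open>z\<close> is set so that \<open>h {z} = K + m z\<close>. The formula
    \<open>K + sum m A\<close> is then extended to all sets of weight at least
    \<open>k\<close>.\<close>
  define K where "K = h (- {z}) - (\<Sum>i\<in>- {z}. h {z, i} - h {z})"
  define m where "m i = (if i = z then h {z} - K else h {z, i} - h {z})" for i
  have mz: "h A = K + sum m A" if "z \<in> A" for A
  proof -
    have "h (insert z B) = K + sum m (insert z B)" if "z \<notin> B" for B
      using finite[of B] that
    proof (induction B)
      case empty
      then show ?case by (simp add: m_def)
    next
      case (insert x B)
      have "insert z B \<inter> {z, x} = {z}"
        using insert.prems insert.hyps by blast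
      then have "h (insert z B) + h {z, x} = h {z} + h (insert z (insert x B))"
        using big[of "insert z B" "{z, x}"] kz[of "{z}"] by (simp only:) (simp add: insert_commute)
      then show ?case
        using insert by (auto simp: m_def)
    qed
    from this[of "A - {z}"] that show ?thesis
      by (simp add: insert_absorb)
  qed
  have mE: "h (- {z}) = K + sum m (- {z})"
    by (simp add: K_def m_def)
  have mbig: "h A = K + sum m A" if "k \<le> sum u A" for A
  proof (cases "z \<in> A")
    case True
    then show ?thesis by (rule mz)
  next
    case False
    \<comment> \<open>A heavy set avoiding \<open>z\<close> is an intersection of two sets whose
      values are known, and the value of their union is known too.\<close>
    then have "- {z} \<inter> insert z A = A" "- {z} \<union> insert z A = UNIV"
      by auto
    with big[of "- {z}" "insert z A"] that
    have "h (- {z}) + h (insert z A) = h A + h UNIV"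
      by simp
    moreover have "sum m UNIV = m z + sum m (- {z})"
      by (metis Compl_eq_Diff_UNIV finite iso_tuple_UNIV_I sum.remove)
    ultimately show ?thesis
      using mz[of "insert z A"] mz[of UNIV] mE False by simp
  qed
  \<comment> \<open>Up to weight \<open>k\<close> nothing is truncated, so the rank is additive
    there and \<open>h\<close> inherits this.\<close>
  have small: "h A = (\<Sum>i\<in>A. h {i})" if "sum u A \<le> k" for A
    using finite[of A] that
  proof (induction A)
    case empty
    then show ?case using h0 by simp
  next
    case (insert x A)
    have "h A + h {x} = h (A \<inter> {x}) + h (A \<union> {x})"
      using insert by (intro tight) (simp add: threshold_rank_def)
    then show ?case
      using insert h0 by simp
  qed
  \<comment> \<open>On a set of weight exactly \<open>k\<close> both descriptions of
    \<open>h\<close> apply, and they give \<open>sum w A = K\<close>. This is the hypothesis of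
    rigidity.\<close>
  define w where "w i = h {i} - m i" for i
  have wA: "sum w A = h A - sum m A" if "sum u A \<le> k" for A
    using small[OF that] by (simp add: w_def sum_subtractf)
  then obtain c where c: "\<forall>i\<in>- {z}. w i = c * real (u i)"
    using rigid mbig unfolding threshold_rigid_def
    by (metis (no_types, lifting) add_diff_cancel_right' order_refl)
  have Kc: "K = c * real k"
  proof -
    have "sum w A0 = c * real (sum u A0)"
      using c A0(1) by (intro sum_scaled_weights) auto
    then show ?thesis
      using wA[of A0] mbig[of A0] A0(2) by simp
  qed
  have "h A = c * threshold_rank k u A + sum m A" for A
  proof (cases "k \<le> sum u A")
    case True
    then show ?thesis
      using mbig Kc by (simp add: threshold_rank_def)
  next
    case False
    then have "A \<subseteq> - {z}"
      using kz by auto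
    then have "sum w A = c * real (sum u A)"
      using c by (intro sum_scaled_weights) auto
    then show ?thesis
      using wA[of A] False by (simp add: threshold_rank_def)
  qed
  then show ?thesis
    by blast
qed

section \<open>Base polytopes of submodular functions\<close>

definition ind_vec :: "'n set \<Rightarrow> real^'n::finite" where
  "ind_vec A = (\<chi> i. if i \<in> A then 1 else 0)"

lemma inner_ind_vec: "ind_vec A \<bullet> x = sum (($) x) A"
proof -
  have "ind_vec A \<bullet> x = (\<Sum>i\<in>UNIV. if i \<in> A then x $ i else 0)"
    by (simp add: ind_vec_def inner_vec_def if_distrib[of "\<lambda>t. t * _"] cong: if_cong)
  also have "\<dots> = sum (($) x) A"
    by (simp add: sum.If_cases)
  finally show ?thesis .
qed

lemma ind_vec_Int_Un: "ind_vec (A \<inter> B) + ind_vec (A \<union> B) = ind_vec A + ind_vec B"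
  by (simp add: ind_vec_def vec_eq_iff)

definition submodular :: "('a set \<Rightarrow> real) \<Rightarrow> bool" where
  "submodular f \<longleftrightarrow> f {} = 0 \<and> (\<forall>A B. f (A \<inter> B) + f (A \<union> B) \<le> f A + f B)"

lemma submodular_empty: "submodular f \<Longrightarrow> f {} = 0"
  by (simp add: submodular_def)

lemma submodularD: "submodular f \<Longrightarrow> f (A \<inter> B) + f (A \<union> B) \<le> f A + f B"
  by (simp add: submodular_def)

definition base_polytope :: "('n set \<Rightarrow> real) \<Rightarrow> (real^'n::finite) set" where
  "base_polytope f = {x. (\<forall>A. sum (($) x) A \<le> f A) \<and> sum (($) x) UNIV = f UNIV}"

section \<open>Greedy vectors and Edmonds' description of the base polytope\<close>

abbreviation (input) ranking :: "('n::finite \<Rightarrow> nat) \<Rightarrow> bool" where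
  "ranking \<sigma> \<equiv> bij_betw \<sigma> UNIV {1..CARD('n)}"

text \<open>The output of Edmonds' greedy algorithm: each element receives its marginal value over
  the elements ranked before it.\<close>

definition greedy :: "('n set \<Rightarrow> real) \<Rightarrow> ('n \<Rightarrow> nat) \<Rightarrow> real^'n::finite" where
  "greedy f \<sigma> = (\<chi> i. f {j. \<sigma> j \<le> \<sigma> i} - f {j. \<sigma> j < \<sigma> i})"

lemma finite_rankings: "finite {\<sigma> :: 'n::finite \<Rightarrow> nat. ranking \<sigma>}"
proof (rule finite_subset)
  show "{\<sigma> :: 'n \<Rightarrow> nat. ranking \<sigma>} \<subseteq> UNIV \<rightarrow>\<^sub>E {1..CARD('n)}"
    by (auto simp: bij_betw_def)
qed (simp add: finite_PiE)

lemma exists_sorting_ranking: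
  fixes d :: "'n::finite \<Rightarrow> real"
  shows "\<exists>\<sigma>. ranking \<sigma> \<and> (\<forall>i j. \<sigma> i < \<sigma> j \<longrightarrow> d j \<le> d i)"
proof -
  have "\<exists>\<sigma>. bij_betw \<sigma> S {1..card S} \<and> (\<forall>i\<in>S. \<forall>j\<in>S. \<sigma> i < \<sigma> j \<longrightarrow> d j \<le> d i)" for S :: "'n set"
    using finite[of S]
  proof (induction "card S" arbitrary: S)
    case 0
    then show ?case by (simp add: bij_betw_def)
  next
    case (Suc n)
    then have "S \<noteq> {}"
      by auto
    \<comment> \<open>An element with the smallest value of \<open>d\<close> is removed and later
      receives the last rank.\<close>
    then obtain x where x: "x \<in> S" "\<And>y. y \<in> S \<Longrightarrow> d x \<le> d y"
      using ex_min_if_finite[of "d ` S"] by (metis (mono_tags) arg_min_if_finite(1) arg_min_least finite)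
    have n: "card (S - {x}) = n"
      using Suc x by simp
    then obtain \<sigma> where \<sigma>: "bij_betw \<sigma> (S - {x}) {1..n}"
      "\<forall>i\<in>S - {x}. \<forall>j\<in>S - {x}. \<sigma> i < \<sigma> j \<longrightarrow> d j \<le> d i"
      using Suc(1)[of "S - {x}"] by auto
    let ?\<sigma> = "\<sigma>(x := Suc n)"
    have "bij_betw ?\<sigma> (S - {x}) {1..n}"
      using \<sigma>(1) by (subst bij_betw_cong[where g = \<sigma>]) auto
    then have "bij_betw ?\<sigma> (S - {x} \<union> {x}) ({1..n} \<union> {?\<sigma> x})"
      by (intro notIn_Un_bij_betw) auto
    moreover have "S - {x} \<union> {x} = S" "{1..n} \<union> {?\<sigma> x} = {1..card S}"
      using x Suc(2) by auto
    ultimately have "bij_betw ?\<sigma> S {1..card S}"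
      by simp
    moreover have "d j \<le> d i" if "i \<in> S" "j \<in> S" "?\<sigma> i < ?\<sigma> j" for i j
    proof -
      have "\<sigma> j \<le> n" if "j \<noteq> x"
        using bij_betw_apply[OF \<sigma>(1), of j] \<open>j \<in> S\<close> that by simp
      then have "i \<noteq> x"
        using that by (cases "j = x") auto
      then show ?thesis
        using \<sigma>(2) x(2) that by (cases "j = x") auto
    qed
    ultimately show ?case by blast
  qed
  from this[of UNIV] show ?thesis by simp
qed

lemma ranking_less_eq:
  assumes "ranking \<sigma>"
  shows "{j. \<sigma> j < \<sigma> i} = {j. \<sigma> j \<le> \<sigma> i} - {i}"
  using assms by (auto simp: bij_betw_def inj_on_def dest: le_neq_implies_less)

text \<open>Lets inductions over prefixes run through all natural numbers: the first case covers the
  values past the last rank.\<close>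

lemma rank_Suc_cases:
  assumes "ranking \<sigma>"
  obtains "{j. \<sigma> j \<le> Suc k} = {j. \<sigma> j \<le> k}"
  | i where "\<sigma> i = Suc k" "{j. \<sigma> j \<le> Suc k} = insert i {j. \<sigma> j \<le> k}" "{j. \<sigma> j < \<sigma> i} = {j. \<sigma> j \<le> k}"
proof (cases "\<exists>i. \<sigma> i = Suc k")
  case True
  then obtain i where i: "\<sigma> i = Suc k" ..
  moreover have "{j. \<sigma> j \<le> Suc k} = insert i {j. \<sigma> j \<le> k}"
    using assms i by (auto simp: le_Suc_eq bij_betw_def inj_on_def)
  ultimately show ?thesis
    using that(2)[of i] by (simp add: less_Suc_eq_le)
next
  case False
  then show ?thesis
    using that(1) by (simp add: le_Suc_eq)
qed

lemma ranking_pos: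
  assumes "ranking (\<sigma> :: 'n::finite \<Rightarrow> nat)"
  shows "0 < \<sigma> i"
proof -
  have "\<sigma> i \<in> {1..CARD('n)}"
    using assms by (auto simp: bij_betw_def)
  then show ?thesis by simp
qed

lemma ranking_UNIV: "ranking (\<sigma> :: 'n::finite \<Rightarrow> nat) \<Longrightarrow> {j. \<sigma> j \<le> CARD('n)} = UNIV"
  by (auto simp: bij_betw_def)

lemma greedy_prefix:
  assumes "ranking \<sigma>" "submodular f"
  shows "sum (($) (greedy f \<sigma>)) {j. \<sigma> j \<le> k} = f {j. \<sigma> j \<le> k}"
proof (induction k)
  case 0
  have "{j. \<sigma> j \<le> 0} = {}"
    using ranking_pos[OF assms(1)] by auto
  then show ?case using submodular_empty[OF assms(2)] by (simp only: sum.empty)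
next
  case (Suc k)
  show ?case
    using assms(1)
  proof (cases rule: rank_Suc_cases[of \<sigma> k])
    case 1
    then show ?thesis using Suc by simp
  next
    case (2 i)
    then have "greedy f \<sigma> $ i = f {j. \<sigma> j \<le> Suc k} - f {j. \<sigma> j \<le> k}"
      by (simp add: greedy_def)
    then show ?thesis using 2 Suc by simp
  qed
qed

text \<open>By induction over the prefixes: submodularity makes the marginal value of
  \<open>i\<close> over a whole prefix at most its marginal value over the part of the prefix inside
  \<open>A\<close>.\<close>

lemma greedy_in_base_polytope:
  fixes \<sigma> :: "'n::finite \<Rightarrow> nat"
  assumes f: "submodular f" and \<sigma>: "ranking \<sigma>"
  shows "greedy f \<sigma> \<in> base_polytope f"
proof -
  let ?x = "greedy f \<sigma>"
  have "sum (($) ?x) (A \<inter> {j. \<sigma> j \<le> k}) \<le> f (A \<inter> {j. \<sigma> j \<le> k})" for A k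
  proof (induction k)
    case 0
    have "{j. \<sigma> j \<le> 0} = {}"
      using ranking_pos[OF \<sigma>] by auto
    then show ?case using submodular_empty[OF f] by (simp only: sum.empty Int_empty_right)
  next
    case (Suc k)
    show ?case
      using \<sigma>
    proof (cases rule: rank_Suc_cases[of \<sigma> k])
      case 1
      then show ?thesis using Suc by simp
    next
      case (2 i)
      let ?P = "{j. \<sigma> j \<le> k}"
      have xi: "?x $ i = f (insert i ?P) - f ?P"
        using 2 by (simp add: greedy_def)
      have iP: "i \<notin> ?P"
        using 2 by simp
      show ?thesis
      proof (cases "i \<in> A")
        case True
        have "insert i (A \<inter> ?P) \<inter> ?P = A \<inter> ?P" "insert i (A \<inter> ?P) \<union> ?P = insert i ?P"
          using iP by auto
        with submodularD[OF f, of "insert i (A \<inter> ?P)" ?P]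
        have "f (A \<inter> ?P) + f (insert i ?P) \<le> f (insert i (A \<inter> ?P)) + f ?P"
          by simp
        then show ?thesis
          using Suc xi 2 True iP by simp
      next
        case False
        then show ?thesis using 2 Suc by simp
      qed
    qed
  qed
  from this[of _ "CARD('n)"] have "sum (($) ?x) A \<le> f A" for A
    using ranking_UNIV[OF \<sigma>] by simp
  moreover have "sum (($) ?x) UNIV = f UNIV"
    using greedy_prefix[OF \<sigma> f, of "CARD('n)"] ranking_UNIV[OF \<sigma>] by simp
  ultimately show ?thesis
    by (simp add: base_polytope_def)
qed

text \<open>Summation by parts in the order of the ranking.\<close>

lemma sum_sorted_nonneg:
  fixes y :: "'n::finite \<Rightarrow> real"
  assumes \<sigma>: "ranking \<sigma>" and d: "\<And>i j. \<sigma> i < \<sigma> j \<Longrightarrow> d j \<le> d i"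
    and y: "\<And>k. 0 \<le> sum y {j. \<sigma> j \<le> k}" and y0: "sum y UNIV = 0"
  shows "0 \<le> (\<Sum>i\<in>UNIV. d i * y i)"
proof -
  \<comment> \<open>The inequality for the prefix ending at \<open>i\<close>. Passing to the next
    rank lowers the coefficient of a nonnegative partial sum; at the last rank the left side
    vanishes because the total of \<open>y\<close> is zero.\<close>
  have "d i * sum y {j. \<sigma> j \<le> k} \<le> (\<Sum>j | \<sigma> j \<le> k. d j * y j)" if "\<sigma> i = k" for i k
    using that
  proof (induction k arbitrary: i)
    case 0
    then show ?case using ranking_pos[OF \<sigma>, of i] by simp
  next
    case (Suc k)
    have pre: "{j. \<sigma> j \<le> Suc k} = insert i {j. \<sigma> j \<le> k}"
      using Suc.prems \<sigma> by (auto simp: le_Suc_eq bij_betw_def inj_on_def)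
    have "d i * sum y {j. \<sigma> j \<le> k} \<le> (\<Sum>j | \<sigma> j \<le> k. d j * y j)"
    proof (cases "k = 0")
      case True
      then have "{j. \<sigma> j \<le> k} = {}"
        using ranking_pos[OF \<sigma>] by auto
      then show ?thesis by (simp only: sum.empty)
    next
      case False
      have "Suc k \<le> CARD('n)"
        using Suc.prems \<sigma> by (metis UNIV_I atLeastAtMost_iff bij_betwE)
      then obtain i' where i': "\<sigma> i' = k"
        using \<sigma> False unfolding bij_betw_def
        by (metis One_nat_def Suc_leD Suc_leI atLeastAtMost_iff gr0I imageE)
      then have "d i * sum y {j. \<sigma> j \<le> k} \<le> d i' * sum y {j. \<sigma> j \<le> k}"
        using d[of i' i] Suc.prems y by (intro mult_right_mono) auto
      also have "\<dots> \<le> (\<Sum>j | \<sigma> j \<le> k. d j * y j)"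
        using Suc.IH i' by simp
      finally show ?thesis .
    qed
    then show ?case
      using pre Suc.prems by (simp add: distrib_left)
  qed
  moreover obtain i where "\<sigma> i = CARD('n)"
    using \<sigma> unfolding bij_betw_def
    by (metis One_nat_def Suc_leI atLeastAtMost_iff imageE order_refl zero_less_card_finite)
  ultimately show ?thesis
    using ranking_UNIV[OF \<sigma>] y0 by (metis mult_zero_right)
qed

text \<open>A point outside the hull would be separated from it by a linear form, but some greedy
  vector does at least as well as the point, because its prefix sums attain the bounds of
  \<open>f\<close>.\<close>

lemma base_polytope_eq_hull:
  assumes f: "submodular f"
  shows "base_polytope f = convex hull (greedy f ` {\<sigma>. ranking \<sigma>})"
proof
  let ?V = "greedy f ` {\<sigma>. ranking \<sigma>}"
  show "base_polytope f \<subseteq> convex hull ?V"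
  proof
    fix x
    assume x: "x \<in> base_polytope f"
    show "x \<in> convex hull ?V"
    proof (rule ccontr)
      assume "x \<notin> convex hull ?V"
      moreover have "closed (convex hull ?V)"
        by (intro compact_imp_closed finite_imp_compact_convex_hull finite_imageI finite_rankings)
      ultimately obtain a b where ab: "a \<bullet> x < b" "\<forall>y\<in>convex hull ?V. b < a \<bullet> y"
        using separating_hyperplane_closed_point[of "convex hull ?V" x] by auto
      \<comment> \<open>The separating form is smaller at \<open>x\<close> than on the hull, so a
        greedy vector minimizing it is wanted; hence the order by \<open>- a\<close>.\<close>
      obtain \<sigma> where \<sigma>: "ranking \<sigma>" "\<forall>i j. \<sigma> i < \<sigma> j \<longrightarrow> - a $ j \<le> - a $ i"
        using exists_sorting_ranking[of "\<lambda>i. - a $ i"] by auto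
      let ?v = "greedy f \<sigma>"
      have "0 \<le> (\<Sum>i\<in>UNIV. - a $ i * (?v - x) $ i)"
      proof (rule sum_sorted_nonneg[OF \<sigma>(1)])
        show "0 \<le> sum (($) (?v - x)) {j. \<sigma> j \<le> k}" for k
          using greedy_prefix[OF \<sigma>(1) f] x
          by (simp add: sum_subtractf base_polytope_def)
        show "sum (($) (?v - x)) UNIV = 0"
          using greedy_in_base_polytope[OF f \<sigma>(1)] x by (simp add: sum_subtractf base_polytope_def)
      qed (use \<sigma>(2) in auto)
      also have "\<dots> = - (a \<bullet> (?v - x))"
        by (simp add: inner_vec_def sum_negf)
      finally have "a \<bullet> ?v \<le> a \<bullet> x"
        by (simp add: inner_diff_right)
      moreover have "b < a \<bullet> ?v"
        using ab(2) \<sigma>(1) by (auto intro: hull_inc)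
      ultimately show False
        using ab(1) by linarith
    qed
  qed
  have "convex (base_polytope f)"
    unfolding base_polytope_def inner_ind_vec[symmetric]
    by (auto simp: convex_def inner_add_right intro!: convex_bound_le simp flip: distrib_right)
  then show "convex hull ?V \<subseteq> base_polytope f"
    using greedy_in_base_polytope[OF f] by (intro hull_minimal) auto
qed

lemma polytope_base_polytope: "submodular f \<Longrightarrow> polytope (base_polytope f)"
  unfolding base_polytope_eq_hull by (intro polytope_convex_hull finite_imageI finite_rankings)

text \<open>Greedy vectors for a fixed ranking are additive in the function. This gives the
  inclusion that is not immediate from the inequalities.\<close>

lemma base_polytope_add:
  assumes "submodular f" "submodular g"
  shows "base_polytope (\<lambda>A. f A + g A) = base_polytope f + base_polytope g"
proof
  have fg: "submodular (\<lambda>A. f A + g A)"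
    using assms unfolding submodular_def by (auto intro: add_mono simp: algebra_simps) (smt (verit))
  have "greedy (\<lambda>A. f A + g A) \<sigma> = greedy f \<sigma> + greedy g \<sigma>" for \<sigma>
    by (simp add: greedy_def vec_eq_iff)
  then have "greedy (\<lambda>A. f A + g A) ` {\<sigma>. ranking \<sigma>} \<subseteq> base_polytope f + base_polytope g"
    using greedy_in_base_polytope assms by (auto intro!: set_plus_intro)
  moreover have "convex (base_polytope f + base_polytope g)"
    using assms by (intro convex_set_plus polytope_imp_convex polytope_base_polytope)
  ultimately show "base_polytope (\<lambda>A. f A + g A) \<subseteq> base_polytope f + base_polytope g"
    unfolding base_polytope_eq_hull[OF fg] by (rule hull_minimal)
  show "base_polytope f + base_polytope g \<subseteq> base_polytope (\<lambda>A. f A + g A)"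
    by (auto simp: base_polytope_def sum.distrib elim!: set_plus_elim intro!: add_mono)
qed

lemma base_polytope_scale:
  assumes "0 < c"
  shows "(\<lambda>x. c *\<^sub>R x) ` base_polytope f = base_polytope (\<lambda>A. c * f A)"
proof
  show "(\<lambda>x. c *\<^sub>R x) ` base_polytope f \<subseteq> base_polytope (\<lambda>A. c * f A)"
    using assms by (auto simp: base_polytope_def simp flip: sum_distrib_left)
  show "base_polytope (\<lambda>A. c * f A) \<subseteq> (\<lambda>x. c *\<^sub>R x) ` base_polytope f"
  proof
    fix x
    assume "x \<in> base_polytope (\<lambda>A. c * f A)"
    then have "(1 / c) *\<^sub>R x \<in> base_polytope f"
      using assms
      by (auto simp: base_polytope_def divide_simps mult.commute simp flip: sum_divide_distrib)
    then show "x \<in> (\<lambda>x. c *\<^sub>R x) ` base_polytope f"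
      using assms by (intro image_eqI[of _ _ "(1 / c) *\<^sub>R x"]) auto
  qed
qed

section \<open>The permutahedron as a base polytope, and its deformations\<close>

text \<open>Closed form of \<open>N + (N - 1) + \<dots>\<close> with \<open>card A\<close> summands, which is the maximum of
  \<open>\<Sum>i\<in>A. x\<^sub>i\<close> over the permutahedron.\<close>

definition permutahedron_rank :: "'n::finite set \<Rightarrow> real" where
  "permutahedron_rank A = real (card A) * (2 * real CARD('n) + 1 - real (card A)) / 2"

text \<open>The product is at least 1 as soon as neither set contains the other, so a large multiple
  of it dominates the defect of any given function on such pairs.\<close>

lemma permutahedron_rank_defect:
  fixes A B :: "'n::finite set"
  shows "permutahedron_rank A + permutahedron_rank B
    - permutahedron_rank (A \<inter> B) - permutahedron_rank (A \<union> B) = real (card (A - B)) * real (card (B - A))"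
proof -
  have "card A = card (A \<inter> B) + card (A - B)" "card B = card (A \<inter> B) + card (B - A)"
    using card_Int_Diff[of A B] card_Int_Diff[of B A] by (simp_all only: finite Int_commute)
  moreover have "card (A \<union> B) + card (A \<inter> B) = card A + card B"
    using card_Un_Int[of A B] by (simp only: finite)
  ultimately have e: "card (A \<union> B) = card (A \<inter> B) + card (A - B) + card (B - A)"
    "card A = card (A \<inter> B) + card (A - B)" "card B = card (A \<inter> B) + card (B - A)"
    by linarith+
  have "(i + a) * (2 * n + 1 - (i + a)) / 2 + (i + b) * (2 * n + 1 - (i + b)) / 2
    - i * (2 * n + 1 - i) / 2 - (i + a + b) * (2 * n + 1 - (i + a + b)) / 2 = a * b" for n i a b :: real
    by (simp add: field_simps)
  then show ?thesis
    unfolding permutahedron_rank_def e of_nat_add .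
qed

lemma submodular_permutahedron_rank: "submodular permutahedron_rank"
  unfolding submodular_def
proof (intro conjI allI)
  show "permutahedron_rank A + permutahedron_rank B
    \<ge> permutahedron_rank (A \<inter> B) + permutahedron_rank (A \<union> B)" for A B :: "'a set"
    using permutahedron_rank_defect[of A B] mult_nonneg_nonneg[of "real (card (A - B))" "real (card (B - A))"]
    by linarith
qed (simp add: permutahedron_rank_def)

lemma ranking_card_prefix:
  assumes \<sigma>: "ranking (\<sigma> :: 'n::finite \<Rightarrow> nat)"
  shows "card {j. \<sigma> j \<le> \<sigma> i} = \<sigma> i"
proof -
  have "\<sigma> ` {j. \<sigma> j \<le> \<sigma> i} = {1..\<sigma> i}"
  proof (intro equalityI subsetI)
    fix k
    assume k: "k \<in> {1..\<sigma> i}"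
    have R: "range \<sigma> = {1..CARD('n)}"
      using \<sigma> by (simp add: bij_betw_def)
    then have "\<sigma> i \<in> {1..CARD('n)}"
      by (metis rangeI)
    with k have "k \<in> range \<sigma>"
      unfolding R by simp
    with k show "k \<in> \<sigma> ` {j. \<sigma> j \<le> \<sigma> i}"
      by auto
  qed (use ranking_pos[OF \<sigma>] in \<open>auto simp: Suc_le_eq\<close>)
  moreover have "inj_on \<sigma> {j. \<sigma> j \<le> \<sigma> i}"
    using \<sigma> by (auto simp: bij_betw_def inj_on_def)
  ultimately show ?thesis
    using card_image[of \<sigma> "{j. \<sigma> j \<le> \<sigma> i}"] by simp
qed

lemma ranking_reverse:
  assumes \<sigma>: "ranking (\<sigma> :: 'n::finite \<Rightarrow> nat)"
  shows "ranking (\<lambda>i. CARD('n) + 1 - \<sigma> i)"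
proof -
  have "bij_betw (\<lambda>k. CARD('n) + 1 - k) {1..CARD('n)} {1..CARD('n)}"
    by (rule bij_betw_byWitness[where f' = "\<lambda>k. CARD('n) + 1 - k"]) auto
  from bij_betw_trans[OF \<sigma> this] show ?thesis
    by (simp add: comp_def)
qed

text \<open>The greedy algorithm gives the largest value to the first element, so each ranking
  yields the vector of the reversed ranking; reversal permutes the rankings.\<close>

lemma permutahedron_eq_base_polytope:
  "(permutahedron :: (real^'n::finite) set) = base_polytope permutahedron_rank"
proof -
  have g: "greedy permutahedron_rank \<sigma> = (\<chi> i. real (CARD('n) + 1 - \<sigma> i))"
    if \<sigma>: "ranking \<sigma>" for \<sigma> :: "'n \<Rightarrow> nat"
  proof -
    have "greedy permutahedron_rank \<sigma> $ i = real (CARD('n) + 1 - \<sigma> i)" for i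
    proof -
      have "card {j. \<sigma> j < \<sigma> i} = \<sigma> i - 1"
        using ranking_less_eq[OF \<sigma>] ranking_card_prefix[OF \<sigma>] by simp
      moreover have "1 \<le> \<sigma> i" "\<sigma> i \<le> CARD('n)"
        using \<sigma> by (auto simp: bij_betw_def)
      ultimately show ?thesis
        using ranking_card_prefix[OF \<sigma>, of i]
        by (simp add: greedy_def permutahedron_rank_def of_nat_diff algebra_simps diff_divide_distrib add_divide_distrib)
    qed
    then show ?thesis by (simp add: vec_eq_iff)
  qed
  have "greedy permutahedron_rank ` {\<sigma> :: 'n \<Rightarrow> nat. ranking \<sigma>} = {\<chi> i. real (\<sigma> i) | \<sigma>. ranking \<sigma>}"
  proof (intro equalityI subsetI)
    fix x :: "real^'n"
    assume "x \<in> {\<chi> i. real (\<sigma> i) | \<sigma>. ranking \<sigma>}"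
    then obtain \<sigma> :: "'n \<Rightarrow> nat" where \<sigma>: "x = (\<chi> i. real (\<sigma> i))" "ranking \<sigma>"
      by auto
    have "\<sigma> i \<le> CARD('n)" for i
      using \<sigma>(2) by (auto simp: bij_betw_def)
    then have "real (\<sigma> i) = real (CARD('n) + 1 - (CARD('n) + 1 - \<sigma> i))" for i
      by (simp add: Suc_diff_le)
    then have "x = greedy permutahedron_rank (\<lambda>i. CARD('n) + 1 - \<sigma> i)"
      using g[OF ranking_reverse[OF \<sigma>(2)]] \<sigma>(1) by (simp only: vec_eq_iff vec_lambda_beta) simp
    then show "x \<in> greedy permutahedron_rank ` {\<sigma>. ranking \<sigma>}"
      using ranking_reverse[OF \<sigma>(2)] by blast
  qed (use g ranking_reverse in fastforce)
  then show ?thesis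
    unfolding permutahedron_def base_polytope_eq_hull[OF submodular_permutahedron_rank] by simp
qed

lemma deformed_permutahedron_base_polytope:
  fixes f :: "'n::finite set \<Rightarrow> real"
  assumes f: "submodular f"
  shows "deformed_permutahedron (base_polytope f)"
proof -
  \<comment> \<open>\<open>D\<close> is the submodularity defect of \<open>f\<close>. It is zero on
    a pair of equal sets, so its maximum is nonnegative and \<open>l\<close> is at least 1.\<close>
  define D where "D p = f (fst p) + f (snd p) - f (fst p \<inter> snd p) - f (fst p \<union> snd p)" for p
  define l where "l = 1 + Max (range D)"
  have D: "f A + f B - f (A \<inter> B) - f (A \<union> B) \<le> l - 1" for A B
  proof -
    have "D (A, B) \<le> Max (range D)"
      by (rule Max_ge) auto
    then show ?thesis
      by (simp add: D_def l_def)
  qed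
  have l: "1 \<le> l"
    using D[of "{}" "{}"] submodular_empty[OF f] by simp
  define g where "g A = l * permutahedron_rank A - f A" for A :: "'n set"
  have g: "submodular g"
    unfolding submodular_def
  proof (intro conjI allI)
    fix A B :: "'n set"
    have "f A + f B - f (A \<inter> B) - f (A \<union> B) \<le> l * (real (card (A - B)) * real (card (B - A)))"
    \<comment> \<open>On comparable pairs both defects vanish; on the others the permutahedron
      contributes at least 1.\<close>
    proof (cases "A \<subseteq> B \<or> B \<subseteq> A")
      case True
      then have "f A + f B - f (A \<inter> B) - f (A \<union> B) = 0"
        by (auto simp: Int_absorb1 Int_absorb2 Un_absorb1 Un_absorb2)
      then show ?thesis using l by simp
    next
      case False
      then have "0 < card (A - B)" "0 < card (B - A)"
        by (auto simp: card_gt_0_iff)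
      then have "1 \<le> card (A - B) * card (B - A)"
        by (metis One_nat_def Suc_leI nat_0_less_mult_iff)
      then have "1 \<le> real (card (A - B)) * real (card (B - A))"
        by (metis of_nat_1 of_nat_le_iff of_nat_mult)
      then have "l * 1 \<le> l * (real (card (A - B)) * real (card (B - A)))"
        using l by (intro mult_left_mono) auto
      then show ?thesis using D[of A B] by linarith
    qed
    then show "g (A \<inter> B) + g (A \<union> B) \<le> g A + g B"
      unfolding permutahedron_rank_defect[symmetric] g_def by (simp add: algebra_simps)
  qed (simp add: g_def permutahedron_rank_def submodular_empty[OF f])
  have "(\<lambda>x. l *\<^sub>R x) ` permutahedron = base_polytope (\<lambda>A. f A + g A)"
    unfolding permutahedron_eq_base_polytope using l by (subst base_polytope_scale) (auto simp: g_def)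
  then show ?thesis
    unfolding deformed_permutahedron_def deformation_def base_polytope_add[OF f g]
    using l polytope_base_polytope f g by (intro conjI exI[of _ l] exI[of _ "base_polytope g"]) auto
qed

section \<open>Common maximizers and indecomposability\<close>

definition maximizer :: "'a::euclidean_space set \<Rightarrow> 'a \<Rightarrow> 'a \<Rightarrow> bool" where
  "maximizer P c x \<longleftrightarrow> x \<in> P \<and> (\<forall>y\<in>P. c \<bullet> y \<le> c \<bullet> x)"

text \<open>The only information about a normal fan that is used below: whether two directions lie
  in a common cone.\<close>

definition common_max :: "'a::euclidean_space set \<Rightarrow> 'a \<Rightarrow> 'a \<Rightarrow> bool" where
  "common_max P c d \<longleftrightarrow> (\<exists>x. maximizer P c x \<and> maximizer P d x)"

definition supp :: "'a::euclidean_space set \<Rightarrow> 'a \<Rightarrow> real" where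
  "supp P c = (SUP x\<in>P. c \<bullet> x)"

lemma supp_eq: "maximizer P c x \<Longrightarrow> supp P c = c \<bullet> x"
  unfolding supp_def maximizer_def by (intro cSup_eq_maximum) auto

lemma exists_maximizer:
  assumes "polytope P" "P \<noteq> {}"
  shows "\<exists>x. maximizer P c x"
proof -
  have "continuous_on P (\<lambda>x. c \<bullet> x)"
    by (intro continuous_intros)
  then show ?thesis
    using continuous_attains_sup[of P "\<lambda>x. c \<bullet> x"] polytope_imp_compact assms
    by (auto simp: maximizer_def)
qed

lemma common_max_iff_normal_fan:
  assumes "convex P"
  shows "common_max P c d \<longleftrightarrow> (\<exists>C\<in>normal_fan P. c \<in> C \<and> d \<in> C)"
proof
  assume "common_max P c d"
  then obtain x where x: "maximizer P c x" "maximizer P d x"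
    by (auto simp: common_max_def)
  \<comment> \<open>On the face where \<open>c + d\<close> is maximal, both \<open>c\<close> and
    \<open>d\<close> are maximal separately, since they have a common maximizer.\<close>
  define F where "F = P \<inter> {y. (c + d) \<bullet> y = (c + d) \<bullet> x}"
  have le: "(c + d) \<bullet> y \<le> (c + d) \<bullet> x" if "y \<in> P" for y
    using x that by (auto simp: maximizer_def inner_add_left intro: add_mono)
  have "F face_of P"
    unfolding F_def by (rule face_of_Int_supporting_hyperplane_le[OF assms le])
  moreover have "x \<in> F"
    using x by (auto simp: F_def maximizer_def)
  moreover have "c \<bullet> y = c \<bullet> x \<and> d \<bullet> y = d \<bullet> x" if "y \<in> F" for y
  proof -
    have "c \<bullet> y \<le> c \<bullet> x" "d \<bullet> y \<le> d \<bullet> x" "c \<bullet> y + d \<bullet> y = c \<bullet> x + d \<bullet> x"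
      using x that by (auto simp: F_def maximizer_def inner_add_left)
    then show ?thesis by linarith
  qed
  then have "c \<in> normal_cone P F" "d \<in> normal_cone P F"
    using x by (auto simp: normal_cone_def maximizer_def)
  ultimately show "\<exists>C\<in>normal_fan P. c \<in> C \<and> d \<in> C"
    unfolding normal_fan_def by blast
next
  assume "\<exists>C\<in>normal_fan P. c \<in> C \<and> d \<in> C"
  then obtain F x where "F face_of P" "x \<in> F" "c \<in> normal_cone P F" "d \<in> normal_cone P F"
    by (auto simp: normal_fan_def)
  then show "common_max P c d"
    using face_of_imp_subset unfolding common_max_def maximizer_def normal_cone_def by blast
qed

lemma normally_equivalent_common_max:
  assumes "normally_equivalent P Q" "convex P" "convex Q"
  shows "common_max P c d \<longleftrightarrow> common_max Q c d"
  using assms by (simp add: common_max_iff_normal_fan normally_equivalent_def)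

text \<open>Take \<open>q\<close> from a decomposition of \<open>l *\<^sub>R x\<close>: exchanging
  it for another point of \<open>Q\<close> stays inside the scaled \<open>P\<close>. The same
  \<open>q\<close> serves all directions \<open>c\<close> at once.\<close>

lemma deformation_maximizer:
  assumes "0 < l" "(\<lambda>x. l *\<^sub>R x) ` P = Q + R" "x \<in> P"
  shows "\<exists>q. \<forall>c. maximizer P c x \<longrightarrow> maximizer Q c q"
proof -
  obtain q r where qr: "q \<in> Q" "r \<in> R" "l *\<^sub>R x = q + r"
    using assms(2,3) by (metis imageI set_plus_elim)
  have "c \<bullet> q' \<le> c \<bullet> q" if max: "maximizer P c x" and q': "q' \<in> Q" for c q'
  proof -
    obtain y where y: "y \<in> P" "q' + r = l *\<^sub>R y"
      using assms(2) qr(2) q' by (metis imageE set_plus_intro)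
    have "c \<bullet> (q' + r) \<le> c \<bullet> (q + r)"
      using max y(1) assms(1) unfolding y(2) qr(3)[symmetric] by (simp add: maximizer_def)
    then show ?thesis by (simp add: inner_add_right)
  qed
  then show ?thesis
    using qr(1) by (auto simp: maximizer_def)
qed

text \<open>The indicators of \<open>A\<close> and \<open>B\<close> have the same sum as those of
  their intersection and union. A common maximizer of the latter pair maximizes this sum, and two
  directions share a maximizer exactly when the support function is additive on them.\<close>

lemma common_max_iff_supp:
  assumes Q: "polytope Q" and chain: "common_max Q (ind_vec (A \<inter> B)) (ind_vec (A \<union> B))"
  shows "common_max Q (ind_vec A) (ind_vec B) \<longleftrightarrow>
    supp Q (ind_vec A) + supp Q (ind_vec B) = supp Q (ind_vec (A \<inter> B)) + supp Q (ind_vec (A \<union> B))"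
    and "supp Q (ind_vec (A \<inter> B)) + supp Q (ind_vec (A \<union> B)) \<le> supp Q (ind_vec A) + supp Q (ind_vec B)"
proof -
  obtain y where y: "maximizer Q (ind_vec (A \<inter> B)) y" "maximizer Q (ind_vec (A \<union> B)) y"
    using chain by (auto simp: common_max_def)
  then have yQ: "y \<in> Q"
    by (simp add: maximizer_def)
  note split = ind_vec_Int_Un[of A B, symmetric]
  have sum_y: "supp Q (ind_vec (A \<inter> B)) + supp Q (ind_vec (A \<union> B)) = (ind_vec A + ind_vec B) \<bullet> y"
    using supp_eq[OF y(1)] supp_eq[OF y(2)] unfolding split by (simp add: inner_add_left)
  have max_y: "(ind_vec A + ind_vec B) \<bullet> x \<le> (ind_vec A + ind_vec B) \<bullet> y" if "x \<in> Q" for x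
  proof -
    have "ind_vec (A \<inter> B) \<bullet> x \<le> ind_vec (A \<inter> B) \<bullet> y" "ind_vec (A \<union> B) \<bullet> x \<le> ind_vec (A \<union> B) \<bullet> y"
      using y that by (simp_all add: maximizer_def)
    then show ?thesis
      unfolding split inner_add_left by (rule add_mono)
  qed
  have le: "c \<bullet> x \<le> supp Q c" if "x \<in> Q" for c x
  proof -
    obtain z where "maximizer Q c z"
      using exists_maximizer[OF Q, of c] yQ by blast
    then show ?thesis
      using supp_eq[of Q c z] that by (simp add: maximizer_def)
  qed
  from le[OF yQ, of "ind_vec A"] le[OF yQ, of "ind_vec B"] sum_y
  show "supp Q (ind_vec (A \<inter> B)) + supp Q (ind_vec (A \<union> B)) \<le> supp Q (ind_vec A) + supp Q (ind_vec B)"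
    by (simp add: inner_add_left)
  show "common_max Q (ind_vec A) (ind_vec B) \<longleftrightarrow>
    supp Q (ind_vec A) + supp Q (ind_vec B) = supp Q (ind_vec (A \<inter> B)) + supp Q (ind_vec (A \<union> B))"
  proof
    assume "common_max Q (ind_vec A) (ind_vec B)"
    then obtain x where x: "maximizer Q (ind_vec A) x" "maximizer Q (ind_vec B) x"
      by (auto simp: common_max_def)
    then have "supp Q (ind_vec A) + supp Q (ind_vec B) = (ind_vec A + ind_vec B) \<bullet> x"
      by (simp add: supp_eq inner_add_left)
    moreover have "(ind_vec A + ind_vec B) \<bullet> y \<le> (ind_vec A + ind_vec B) \<bullet> x"
      using x yQ unfolding inner_add_left by (intro add_mono) (simp_all add: maximizer_def)
    moreover have "(ind_vec A + ind_vec B) \<bullet> x \<le> (ind_vec A + ind_vec B) \<bullet> y"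
      using x(1) max_y by (simp add: maximizer_def)
    ultimately show "supp Q (ind_vec A) + supp Q (ind_vec B)
        = supp Q (ind_vec (A \<inter> B)) + supp Q (ind_vec (A \<union> B))"
      using sum_y by linarith
  next
    assume "supp Q (ind_vec A) + supp Q (ind_vec B)
        = supp Q (ind_vec (A \<inter> B)) + supp Q (ind_vec (A \<union> B))"
    with sum_y le[OF yQ, of "ind_vec A"] le[OF yQ, of "ind_vec B"]
    have "ind_vec A \<bullet> y = supp Q (ind_vec A)" "ind_vec B \<bullet> y = supp Q (ind_vec B)"
      unfolding inner_add_left by linarith+
    then have "maximizer Q (ind_vec A) y" "maximizer Q (ind_vec B) y"
      using yQ le by (simp_all add: maximizer_def)
    then show "common_max Q (ind_vec A) (ind_vec B)"
      unfolding common_max_def by blast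
  qed
qed

lemma supp_ind_vec_empty: "Q \<noteq> {} \<Longrightarrow> supp Q (ind_vec {}) = 0"
  by (simp add: supp_def inner_ind_vec)

section \<open>Tight sets and chains in base polytopes\<close>

lemma greedy_maximizer:
  assumes f: "submodular f" and \<sigma>: "ranking \<sigma>"
  shows "maximizer (base_polytope f) (ind_vec {j. \<sigma> j \<le> k}) (greedy f \<sigma>)"
  using greedy_in_base_polytope[OF assms] greedy_prefix[OF \<sigma> f]
  by (auto simp: maximizer_def inner_ind_vec base_polytope_def)

lemma ranking_downset:
  assumes \<sigma>: "ranking (\<sigma> :: 'n::finite \<Rightarrow> nat)" and D: "\<And>i j. i \<in> D \<Longrightarrow> \<sigma> j < \<sigma> i \<Longrightarrow> j \<in> D"
  shows "\<exists>k. D = {j. \<sigma> j \<le> k}"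
proof (cases "D = {}")
  case True
  then have "D = {j. \<sigma> j \<le> 0}"
    using ranking_pos[OF \<sigma>] by auto
  then show ?thesis by blast
next
  case False
  then have "Max (\<sigma> ` D) \<in> \<sigma> ` D"
    by (intro Max_in) auto
  then obtain i where i: "i \<in> D" "\<sigma> i = Max (\<sigma> ` D)"
    by auto
  have "D = {j. \<sigma> j \<le> \<sigma> i}"
  proof (intro equalityI subsetI)
    fix j
    assume j: "j \<in> {j. \<sigma> j \<le> \<sigma> i}"
    show "j \<in> D"
    proof (cases "\<sigma> j = \<sigma> i")
      case True
      then have "j = i"
        by (rule injD[OF bij_betw_imp_inj_on[OF \<sigma>]])
      then show ?thesis using i(1) by simp
    next
      case False
      then show ?thesis using D[OF i(1)] j by simp
    qed
  qed (simp add: i)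
  then show ?thesis by blast
qed

text \<open>A ranking that lists \<open>A\<close> first, then the rest of \<open>B\<close>, makes
  both sets prefixes, and its greedy vector maximizes both indicators. Sorting by the sum of the two
  indicators produces such a ranking.\<close>

lemma base_polytope_chain:
  assumes f: "submodular f" and AB: "A \<subseteq> B"
  shows "common_max (base_polytope f) (ind_vec A) (ind_vec B)"
proof -
  obtain \<sigma> where \<sigma>: "ranking \<sigma>"
    "\<forall>i j. \<sigma> i < \<sigma> j \<longrightarrow> (if j \<in> A then 1 else 0) + (if j \<in> B then 1 else 0)
      \<le> (if i \<in> A then 1 else 0) + (if i \<in> B then 1 else 0 :: real)"
    using exists_sorting_ranking[of "\<lambda>i. (if i \<in> A then 1 else 0) + (if i \<in> B then 1 else 0)"] by auto
  have "j \<in> A" if "i \<in> A" "\<sigma> j < \<sigma> i" for i j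
    using \<sigma>(2)[rule_format, OF that(2)] that(1) AB by (auto split: if_splits)
  then obtain k where k: "A = {j. \<sigma> j \<le> k}"
    using ranking_downset[OF \<sigma>(1), of A] by auto
  have "j \<in> B" if "i \<in> B" "\<sigma> j < \<sigma> i" for i j
    using \<sigma>(2)[rule_format, OF that(2)] that(1) AB by (auto split: if_splits)
  then obtain k' where "B = {j. \<sigma> j \<le> k'}"
    using ranking_downset[OF \<sigma>(1), of B] by auto
  with k show ?thesis
    using greedy_maximizer[OF f \<sigma>(1)] unfolding common_max_def by auto
qed

lemma base_polytope_nonempty: "submodular f \<Longrightarrow> base_polytope f \<noteq> {}"
  using base_polytope_chain[of f "{}" "{}"] by (auto simp: common_max_def maximizer_def)

text \<open>Every set is a prefix of some ranking, so each bound of \<open>f\<close> is attained by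
  a greedy vector.\<close>

lemma supp_base_polytope:
  assumes f: "submodular f"
  shows "supp (base_polytope f) (ind_vec A) = f A"
proof -
  obtain \<sigma> where \<sigma>: "ranking \<sigma>"
    "\<forall>i j. \<sigma> i < \<sigma> j \<longrightarrow> (if j \<in> A then 1 else 0) \<le> (if i \<in> A then 1 else 0 :: real)"
    using exists_sorting_ranking[of "\<lambda>i. if i \<in> A then 1 else 0"] by auto
  then obtain k where "A = {j. \<sigma> j \<le> k}"
    using ranking_downset[OF \<sigma>(1), of A] by (metis not_one_le_zero)
  then show ?thesis
    using supp_eq[OF greedy_maximizer[OF f \<sigma>(1), of k]] greedy_prefix[OF \<sigma>(1) f]
    by (simp add: inner_ind_vec)
qed

text \<open>The normal fan determines on which pairs \<open>f\<close> is modular; this allows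
  rigidity to be applied to any polytope with the same fan.\<close>

lemma normally_equivalent_tight_iff:
  assumes f: "submodular f" and Q: "polytope Q" and eq: "normally_equivalent (base_polytope f) Q"
  shows "f A + f B = f (A \<inter> B) + f (A \<union> B) \<longleftrightarrow>
    supp Q (ind_vec A) + supp Q (ind_vec B) = supp Q (ind_vec (A \<inter> B)) + supp Q (ind_vec (A \<union> B))"
proof -
  have com: "common_max (base_polytope f) c d \<longleftrightarrow> common_max Q c d" for c d
    using normally_equivalent_common_max[OF eq] polytope_base_polytope[OF f] Q polytope_imp_convex
    by blast
  have chain: "common_max (base_polytope f) (ind_vec (A \<inter> B)) (ind_vec (A \<union> B))"
    by (rule base_polytope_chain[OF f]) auto
  show ?thesis
    using common_max_iff_supp(1)[OF polytope_base_polytope[OF f] chain]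
      common_max_iff_supp(1)[OF Q chain[unfolded com]]
    unfolding com supp_base_polytope[OF f] by blast
qed

text \<open>The support function of a deformation is modular wherever \<open>f\<close> is, hence of
  the form \<open>c * f\<close> plus a modular function. The strict pair excludes negative
  \<open>c\<close>, and the modular part becomes the translation.\<close>

lemma indecomposable_base_polytope:
  fixes f :: "'n::finite set \<Rightarrow> real"
  assumes f: "submodular f" and strict: "f (A0 \<inter> B0) + f (A0 \<union> B0) < f A0 + f B0"
    and rigid: "\<And>h. h {} = 0 \<Longrightarrow> (\<And>A B. f A + f B = f (A \<inter> B) + f (A \<union> B) \<Longrightarrow>
        h A + h B = h (A \<inter> B) + h (A \<union> B)) \<Longrightarrow> \<exists>c m. \<forall>A. h A = c * f A + sum m A"
  shows "indecomposable (base_polytope f)"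
  unfolding indecomposable_def
proof (intro conjI allI impI)
  let ?P = "base_polytope f"
  show "polytope ?P"
    by (rule polytope_base_polytope[OF f])
  fix Q
  assume "deformation Q ?P"
  then obtain l R where Q: "polytope Q" and l: "0 < l" and R: "(\<lambda>x. l *\<^sub>R x) ` ?P = Q + R"
    by (auto simp: deformation_def)
  have "Q \<noteq> {}"
    using R base_polytope_nonempty[OF f] by (auto simp: set_plus_def)
  define g where "g A = supp Q (ind_vec A)" for A
  have transfer: "\<exists>q. \<forall>c. maximizer ?P c x \<longrightarrow> maximizer Q c q" if "x \<in> ?P" for x
    using deformation_maximizer[OF l R that] .
  have com: "common_max Q c d" if "common_max ?P c d" for c d
  proof -
    obtain x where x: "maximizer ?P c x" "maximizer ?P d x"
      using \<open>common_max ?P c d\<close> by (auto simp: common_max_def)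
    then have "x \<in> ?P"
      by (simp add: maximizer_def)
    from transfer[OF this] x show ?thesis
      unfolding common_max_def by blast
  qed
  have chain: "common_max Q (ind_vec (A \<inter> B)) (ind_vec (A \<union> B))" for A B :: "'n set"
    by (intro com base_polytope_chain[OF f]) auto
  have "g A + g B = g (A \<inter> B) + g (A \<union> B)" if "f A + f B = f (A \<inter> B) + f (A \<union> B)" for A B
  proof -
    have "common_max ?P (ind_vec (A \<inter> B)) (ind_vec (A \<union> B))"
      by (intro base_polytope_chain[OF f]) auto
    from common_max_iff_supp(1)[OF polytope_base_polytope[OF f] this] that
    have "common_max ?P (ind_vec A) (ind_vec B)"
      unfolding supp_base_polytope[OF f] by blast
    from com[OF this] common_max_iff_supp(1)[OF Q chain] show ?thesis
      unfolding g_def by blast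
  qed
  moreover have "g {} = 0"
    using supp_ind_vec_empty[OF \<open>Q \<noteq> {}\<close>] by (simp add: g_def)
  ultimately obtain c m where g: "\<And>A. g A = c * f A + sum m A"
    using rigid by metis
  have "0 \<le> c"
  proof -
    have "g (A0 \<inter> B0) + g (A0 \<union> B0) \<le> g A0 + g B0"
      using common_max_iff_supp(2)[OF Q chain] unfolding g_def .
    moreover have "sum m (A0 \<inter> B0) + sum m (A0 \<union> B0) = sum m A0 + sum m B0"
      using sum.union_inter[of A0 B0 m] by simp
    ultimately have "0 \<le> c * (f A0 + f B0 - (f (A0 \<inter> B0) + f (A0 \<union> B0)))"
      by (simp add: g algebra_simps)
    then show ?thesis
      using strict by (simp add: zero_le_mult_iff)
  qed
  define t :: "real^'n" where "t = (\<chi> i. m i)"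
  have gle: "sum (($) q) A \<le> g A" if "q \<in> Q" for q A
  proof -
    obtain x where "maximizer Q (ind_vec A) x"
      using exists_maximizer[OF Q \<open>Q \<noteq> {}\<close>] by blast
    then show ?thesis
      using that supp_eq[of Q "ind_vec A" x] by (auto simp: g_def maximizer_def inner_ind_vec)
  qed
  have gE: "sum (($) q) UNIV = g UNIV" if "q \<in> Q" for q
  proof -
    obtain x where x: "x \<in> ?P"
      using base_polytope_nonempty[OF f] by auto
    \<comment> \<open>The coordinate sum is constant on the base polytope, so \<open>x\<close>
      maximizes it and its negative. Transferring both shows that the coordinate sum is constant on
      \<open>Q\<close> as well.\<close>
    then have "maximizer ?P (ind_vec UNIV) x" "maximizer ?P (- ind_vec UNIV) x"
      by (auto simp: maximizer_def inner_ind_vec base_polytope_def)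
    then obtain q0 where q0: "maximizer Q (ind_vec UNIV) q0" "maximizer Q (- ind_vec UNIV) q0"
      using transfer[OF x] by blast
    then have "ind_vec UNIV \<bullet> q = ind_vec UNIV \<bullet> q0"
      using that by (auto simp: maximizer_def intro: order_antisym)
    then show ?thesis
      using supp_eq[OF q0(1)] by (simp add: g_def inner_ind_vec)
  qed
  have "Q = (\<lambda>x. c *\<^sub>R x + t) ` ?P"
  proof (intro equalityI subsetI)
    fix q
    assume q: "q \<in> Q"
    have "q - t \<in> base_polytope (\<lambda>A. c * f A)"
      using gle[OF q] gE[OF q] by (simp add: base_polytope_def sum_subtractf t_def g algebra_simps)
    moreover have "base_polytope (\<lambda>A. c * f A) \<subseteq> (\<lambda>x. c *\<^sub>R x) ` ?P"
    \<comment> \<open>For \<open>c = 0\<close> the scaling lemma does not apply; there the base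
      polytope of the zero function is the origin alone.\<close>
    proof (cases "c = 0")
      case True
      have "x = 0" if "x \<in> base_polytope (\<lambda>A. c * f A)" for x
      proof -
        have x: "sum (($) x) A \<le> 0" "sum (($) x) UNIV = 0" for A
          using that True by (auto simp: base_polytope_def)
        have "x $ i = 0" for i
          using x(1)[of "{i}"] x(1)[of "UNIV - {i}"] x(2) sum.remove[of UNIV i "($) x"] by simp
        then show ?thesis by (simp add: vec_eq_iff)
      qed
      then show ?thesis
        using True base_polytope_nonempty[OF f] by auto
    next
      case False
      then show ?thesis
        using base_polytope_scale[of c f] \<open>0 \<le> c\<close> by simp
    qed
    ultimately obtain p where "p \<in> ?P" "q - t = c *\<^sub>R p"
      by auto
    then show "q \<in> (\<lambda>x. c *\<^sub>R x + t) ` ?P"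
      by (intro image_eqI[of _ _ p]) (auto simp: algebra_simps)
  next
    have "greedy f ` {\<sigma>. ranking \<sigma>} \<subseteq> {x. c *\<^sub>R x + t \<in> Q}"
    proof clarify
      fix \<sigma> :: "'n \<Rightarrow> nat"
      assume \<sigma>: "ranking \<sigma>"
      \<comment> \<open>One \<open>q\<close> maximizes all prefix directions at once, so its prefix
        sums, and with them its coordinates, are determined.\<close>
      obtain q where q: "\<And>d. maximizer ?P d (greedy f \<sigma>) \<Longrightarrow> maximizer Q d q"
        using transfer greedy_in_base_polytope[OF f \<sigma>] by blast
      have pre: "sum (($) q) {j. \<sigma> j \<le> k} = c * f {j. \<sigma> j \<le> k} + sum m {j. \<sigma> j \<le> k}" for k
        using supp_eq[OF q[OF greedy_maximizer[OF f \<sigma>, of k]]] g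
        by (simp add: g_def inner_ind_vec)
      have "q $ i = c * greedy f \<sigma> $ i + m i" for i
      proof -
        have "{j. \<sigma> j < \<sigma> i} = {j. \<sigma> j \<le> \<sigma> i - 1}"
          using ranking_pos[OF \<sigma>, of i] by auto
        then have "sum (($) q) {j. \<sigma> j < \<sigma> i} = c * f {j. \<sigma> j < \<sigma> i} + sum m {j. \<sigma> j < \<sigma> i}"
          using pre[of "\<sigma> i - 1"] by simp
        moreover have "{j. \<sigma> j \<le> \<sigma> i} = insert i {j. \<sigma> j < \<sigma> i}"
          using ranking_less_eq[OF \<sigma>, of i] by auto
        ultimately show ?thesis
          using pre[of "\<sigma> i"] by (simp add: greedy_def algebra_simps)
      qed
      then have "q = c *\<^sub>R greedy f \<sigma> + t"
        by (simp add: vec_eq_iff t_def)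
      then show "c *\<^sub>R greedy f \<sigma> + t \<in> Q"
        using q[OF greedy_maximizer[OF f \<sigma>, of 0]] by (simp add: maximizer_def)
    qed
    moreover have "convex {x. c *\<^sub>R x + t \<in> Q}"
    proof (rule convexI)
      fix x y and u v :: real
      assume xy: "x \<in> {x. c *\<^sub>R x + t \<in> Q}" "y \<in> {x. c *\<^sub>R x + t \<in> Q}" and uv: "0 \<le> u" "0 \<le> v" "u + v = 1"
      have "u *\<^sub>R (c *\<^sub>R x + t) + v *\<^sub>R (c *\<^sub>R y + t) = c *\<^sub>R (u *\<^sub>R x + v *\<^sub>R y) + (u + v) *\<^sub>R t"
        by (simp add: algebra_simps)
      then show "u *\<^sub>R x + v *\<^sub>R y \<in> {x. c *\<^sub>R x + t \<in> Q}"
        using convexD[OF polytope_imp_convex[OF Q], of "c *\<^sub>R x + t" "c *\<^sub>R y + t" u v] xy uv by simp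
    qed
    ultimately have "?P \<subseteq> {x. c *\<^sub>R x + t \<in> Q}"
      unfolding base_polytope_eq_hull[OF f] by (rule hull_minimal)
    then show "q \<in> Q" if "q \<in> (\<lambda>x. c *\<^sub>R x + t) ` ?P" for q
      using that by auto
  qed
  with \<open>0 \<le> c\<close> show "\<exists>l\<ge>0. \<exists>t. Q = (\<lambda>x. l *\<^sub>R x + t) ` ?P"
    by blast
qed

section \<open>Threshold polytopes\<close>

text \<open>The bound \<open>u i \<le> k\<close> keeps singletons untruncated. An element
  \<open>a\<close> of weight 1 forms with \<open>z\<close> a pair on which submodularity is strict,
  and it fixes the scale when weights are compared.\<close>

definition admissible :: "'n::finite \<Rightarrow> ('n \<Rightarrow> nat) \<Rightarrow> nat \<Rightarrow> bool" where
  "admissible z u k \<longleftrightarrow> u z = k \<and> 2 \<le> k \<and> k \<le> sum u (- {z}) \<and> (\<forall>i. u i \<le> k) \<and> (\<forall>i. 1 \<le> u i) \<and>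
     (\<exists>a. a \<noteq> z \<and> u a = 1) \<and> (\<exists>A0\<subseteq>- {z}. sum u A0 = k) \<and> threshold_rigid (- {z}) u k"

lemma insert_Compl_singleton: "insert z (- {z}) = UNIV"
  by auto

lemma submodular_threshold_rank: "submodular (threshold_rank k (u :: 'n::finite \<Rightarrow> nat))"
  unfolding submodular_def using threshold_rank_submodular by (auto simp: threshold_rank_def)

lemma admissible_strict:
  assumes "admissible z u k" "a \<noteq> z" "u a = 1"
  shows "threshold_rank k u ({z} \<inter> {a}) + threshold_rank k u ({z} \<union> {a})
    < threshold_rank k u {z} + threshold_rank k u {a}"
  using assms by (auto simp: admissible_def threshold_rank_def)

lemma admissible_rigid:
  assumes "admissible z u k" "h {} = 0"
    and "\<And>A B. threshold_rank k u A + threshold_rank k u B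
        = threshold_rank k u (A \<inter> B) + threshold_rank k u (A \<union> B)
      \<Longrightarrow> h A + h B = h (A \<inter> B) + h (A \<union> B)"
  shows "\<exists>c m. \<forall>A. h A = c * threshold_rank k u A + sum m A"
proof -
  obtain A0 where "A0 \<subseteq> - {z}" "sum u A0 = k"
    using assms(1) by (auto simp: admissible_def)
  then show ?thesis
    using assms(1) by (intro threshold_rank_rigid[of u z k A0] assms(2,3)) (auto simp: admissible_def)
qed

lemma admissible_indecomposable:
  assumes "admissible z u k"
  shows "indecomposable (base_polytope (threshold_rank k u))"
proof -
  obtain a where a: "a \<noteq> z" "u a = 1"
    using assms by (auto simp: admissible_def)
  show ?thesis
    by (rule indecomposable_base_polytope[OF submodular_threshold_rank admissible_strict[OF assms a]])
      (rule admissible_rigid[OF assms])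
qed

section \<open>Comparison with matroid polytopes\<close>

lemma polytope_matroid_polytope: "polytope (matroid_polytope \<B>)"
  unfolding matroid_polytope_def Setcompr_eq_image
  by (intro polytope_convex_hull finite_imageI finite)

text \<open>The right-hand side is the rank of \<open>A\<close> when \<open>\<B>\<close> consists of
  the bases of a matroid: a linear form is maximal at a generating point, and the indicator of
  \<open>A\<close> counts the elements of the basis inside \<open>A\<close>.\<close>

lemma supp_matroid_polytope:
  assumes "\<B> \<noteq> {}"
  shows "supp (matroid_polytope \<B>) (ind_vec A) = real (MAX B\<in>\<B>. card (A \<inter> B))"
proof -
  let ?v = "\<lambda>B. \<Sum>x\<in>B. axis x 1 :: real^'a"
  let ?M = "MAX B\<in>\<B>. card (A \<inter> B)"
  have v: "ind_vec A \<bullet> ?v B = real (card (A \<inter> B))" for B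
  proof -
    have "ind_vec A \<bullet> ?v B = (\<Sum>x\<in>B. if x \<in> A then 1 else 0)"
      by (simp add: inner_sum_right inner_axis ind_vec_def)
    then show ?thesis
      by (simp add: sum.If_cases Int_commute)
  qed
  have "?M \<in> (\<lambda>B. card (A \<inter> B)) ` \<B>"
    using assms by (intro Max_in) auto
  then obtain B0 where B0: "B0 \<in> \<B>" "card (A \<inter> B0) = ?M"
    by auto
  have "card (A \<inter> B) \<le> ?M" if "B \<in> \<B>" for B
    using that by (intro Max_ge) auto
  then have "{?v B | B. B \<in> \<B>} \<subseteq> {y. ind_vec A \<bullet> y \<le> real ?M}"
    using v by auto
  then have "matroid_polytope \<B> \<subseteq> {y. ind_vec A \<bullet> y \<le> real ?M}"
    unfolding matroid_polytope_def by (rule hull_minimal) (rule convex_halfspace_le)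
  moreover have "?v B0 \<in> matroid_polytope \<B>"
    unfolding matroid_polytope_def using B0(1) by (intro hull_inc) auto
  ultimately have "maximizer (matroid_polytope \<B>) (ind_vec A) (?v B0)"
    using B0(2) v[of B0] by (auto simp: maximizer_def)
  from supp_eq[OF this] show ?thesis
    using v[of B0] B0(2) by simp
qed

lemma matroid_marginal:
  fixes \<B> :: "'n::finite set set"
  assumes "\<B> \<noteq> {}"
  shows "supp (matroid_polytope \<B>) (ind_vec (insert i A)) - supp (matroid_polytope \<B>) (ind_vec A) \<in> {0, 1}"
proof -
  define M where "M A = (MAX B\<in>\<B>. card (A \<inter> B))" for A
  have ge: "card (A \<inter> B) \<le> M A" if "B \<in> \<B>" for A B
    unfolding M_def using that by (intro Max_ge) auto
  have ex: "\<exists>B\<in>\<B>. card (A \<inter> B) = M A" for A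
  proof -
    have "M A \<in> (\<lambda>B. card (A \<inter> B)) ` \<B>"
      unfolding M_def using assms by (intro Max_in) auto
    then show ?thesis by auto
  qed
  have "M A \<le> M (insert i A)"
  proof -
    obtain B where B: "B \<in> \<B>" "card (A \<inter> B) = M A"
      using ex by auto
    have "card (A \<inter> B) \<le> card (insert i A \<inter> B)"
      by (intro card_mono) auto
    then show ?thesis using ge[OF B(1), of "insert i A"] B(2) by linarith
  qed
  moreover have "M (insert i A) \<le> Suc (M A)"
  proof -
    obtain B where B: "B \<in> \<B>" "card (insert i A \<inter> B) = M (insert i A)"
      using ex by auto
    have "card (insert i A \<inter> B) \<le> card (insert i (A \<inter> B))"
      by (intro card_mono) auto
    also have "\<dots> \<le> Suc (card (A \<inter> B))"
      by (simp add: card_insert_if)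
    finally show ?thesis using ge[OF B(1), of A] B(2) by linarith
  qed
  ultimately have "M (insert i A) = M A \<or> M (insert i A) = Suc (M A)"
    by linarith
  then show ?thesis
    unfolding supp_matroid_polytope[OF assms] M_def[symmetric] by auto
qed

text \<open>Along \<open>z\<close> the rank has the three different increments k, k - 1 and 0, whereas a matroid rank
  function only has the increments 0 and 1.\<close>

lemma admissible_not_matroid:
  assumes adm: "admissible z u k" and \<B>: "matroid_bases \<B>"
  shows "\<not> normally_equivalent (base_polytope (threshold_rank k u)) (matroid_polytope \<B>)"
proof
  let ?f = "threshold_rank k u" and ?r = "\<lambda>A. supp (matroid_polytope \<B>) (ind_vec A)"
  assume "normally_equivalent (base_polytope ?f) (matroid_polytope \<B>)"
  note tight = normally_equivalent_tight_iff[OF submodular_threshold_rank polytope_matroid_polytope this]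
  have ne: "\<B> \<noteq> {}"
    using \<B> by (simp add: matroid_bases_def)
  have "?r {} = 0"
    unfolding supp_matroid_polytope[OF ne] using ne by simp
  then obtain c m where r: "\<And>A. ?r A = c * ?f A + sum m A"
    using admissible_rigid[OF adm, of ?r] tight by blast
  obtain a where a: "a \<noteq> z" "u a = 1"
    using adm by (auto simp: admissible_def)
  \<comment> \<open>Otherwise the matroid rank would be modular on the pair \<open>{z}\<close>,
    \<open>{a}\<close>, where the truncated weight is not.\<close>
  have "c \<noteq> 0"
  proof
    assume "c = 0"
    then have "?r {z} + ?r {a} = ?r ({z} \<inter> {a}) + ?r ({z} \<union> {a})"
      unfolding r using a by (simp only:) simp
    then show False
      using tight[of "{z}" "{a}"] admissible_strict[OF adm a] by linarith
  qed
  have k: "2 \<le> k" "u z = k" "k \<le> sum u (- {z})"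
    using adm by (auto simp: admissible_def)
  moreover have "sum u UNIV = k + sum u (- {z})"
    using k(2) sum.remove[of UNIV z u] by (simp add: Compl_eq_Diff_UNIV)
  ultimately have f: "?f {} = 0" "?f {z} = real k" "?f {a} = 1" "?f {z, a} = real k"
    "?f (- {z}) = real k" "?f UNIV = real k"
    using a by (auto simp: threshold_rank_def)
  \<comment> \<open>The marginals along \<open>z\<close> are taken over the empty set,
    \<open>{a}\<close> and the complement of \<open>{z}\<close>. They are pairwise distinct because
    \<open>c\<close> is nonzero and \<open>k\<close> is at least 2.\<close>
  have "c * real k + m z \<in> {0, 1}"
    using matroid_marginal[OF ne, of z "{}"] unfolding r f by simp
  moreover have "c * (real k - 1) + m z \<in> {0, 1}"
    using matroid_marginal[OF ne, of z "{a}"] a unfolding r f by (simp add: algebra_simps)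
  moreover have "sum m UNIV = m z + sum m (- {z})"
    using sum.remove[of UNIV z m] by (simp add: Compl_eq_Diff_UNIV)
  then have "m z \<in> {0, 1}"
    using matroid_marginal[OF ne, of z "- {z}"] unfolding r insert_Compl_singleton f by simp
  moreover have "c * real k \<noteq> 0" "c * (real k - 1) \<noteq> 0" "c * real k = c * (real k - 1) + c"
    using \<open>c \<noteq> 0\<close> k(1) by (simp_all add: algebra_simps)
  ultimately show False
    using \<open>c \<noteq> 0\<close> unfolding insert_iff empty_iff simp_thms by linarith
qed

text \<open>Rigidity writes one rank as \<open>c\<close> times the other plus a modular function.
  Both are constant on the sets containing \<open>z\<close>, so the modular part vanishes off
  \<open>z\<close> and the weights there are proportional.\<close>

lemma admissible_normally_equivalent:
  assumes adm: "admissible z u k" and adm': "admissible z u' k'"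
    and eq: "normally_equivalent (base_polytope (threshold_rank k u)) (base_polytope (threshold_rank k' u'))"
    and i: "i \<noteq> z"
  shows "u i = u' i"
proof -
  let ?f = "threshold_rank k u" and ?g = "threshold_rank k' u'"
  have "?f A + ?f B = ?f (A \<inter> B) + ?f (A \<union> B) \<longleftrightarrow> ?g A + ?g B = ?g (A \<inter> B) + ?g (A \<union> B)" for A B
    using normally_equivalent_tight_iff[OF submodular_threshold_rank
        polytope_base_polytope[OF submodular_threshold_rank] eq]
    unfolding supp_base_polytope[OF submodular_threshold_rank] .
  then obtain c m where g: "\<And>A. ?g A = c * ?f A + sum m A"
    using admissible_rigid[OF adm, of ?g] submodular_empty[OF submodular_threshold_rank] by metis
  have fz: "?f A = real k" "?g A = real k'" if "z \<in> A" for A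
  proof -
    have "u z \<le> sum u A" "u' z \<le> sum u' A"
      using that by (auto intro: member_le_sum)
    then show "?f A = real k" "?g A = real k'"
      using adm adm' by (simp_all add: admissible_def threshold_rank_def)
  qed
  have single: "?f {j} = real (u j)" "?g {j} = real (u' j)" for j
    using adm adm' by (simp_all add: admissible_def threshold_rank_def)
  have "real (u' j) = c * real (u j)" if "j \<noteq> z" for j
  proof -
    have "m j = 0"
      using g[of "{z, j}"] g[of "{z}"] fz that by simp
    then show ?thesis
      using g[of "{j}"] single by simp
  qed
  note scale = this
  \<comment> \<open>Each weighting has an element of weight 1 and no smaller weight:
    \<open>a\<close> gives that \<open>c\<close> is at least 1, and \<open>a'\<close> that it is at
    most 1.\<close>
  obtain a a' where a: "a \<noteq> z" "u a = 1" "a' \<noteq> z" "u' a' = 1"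
    using adm adm' by (auto simp: admissible_def)
  have "1 \<le> u a'" "1 \<le> u' a"
    using adm adm' by (auto simp: admissible_def)
  then have "1 \<le> c"
    using scale[of a] a by simp
  moreover have "c * 1 \<le> c * real (u a')"
    using \<open>1 \<le> c\<close> \<open>1 \<le> u a'\<close> by (intro mult_left_mono) auto
  then have "c \<le> 1"
    using scale[of a'] a by simp
  ultimately show ?thesis
    using scale[OF i] by simp
qed

section \<open>Arrangements of the weights and their number\<close>

text \<open>A list of \<open>N - 4\<close> elements encodes an arrangement: its members receive 2,
  3, ..., \<open>N - 3\<close>. The default 1 is meant for the three elements other than
  \<open>z\<close> that are left over; the value at \<open>z\<close> is overwritten by the
  threshold.\<close>

definition list_weight :: "'a list \<Rightarrow> 'a \<Rightarrow> nat" where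
  "list_weight xs i = (if i \<in> set xs then (THE j. j < length xs \<and> xs ! j = i) + 2 else 1)"

lemma list_weight_nth:
  assumes "distinct xs" "j < length xs"
  shows "list_weight xs (xs ! j) = j + 2"
proof -
  have "(THE j'. j' < length xs \<and> xs ! j' = xs ! j) = j"
    using assms by (intro the_equality) (auto simp: nth_eq_iff_index_eq)
  then show ?thesis
    using assms by (simp add: list_weight_def)
qed

lemma list_weight_inject:
  assumes "distinct xs" "distinct ys" "length xs = length ys"
    and "\<And>i. i \<in> set xs \<Longrightarrow> list_weight xs i = list_weight ys i"
  shows "xs = ys"
proof (rule nth_equalityI)
  fix j
  assume j: "j < length xs"
  then have w: "list_weight ys (xs ! j) = j + 2"
    using list_weight_nth[of xs j] assms by simp
  \<comment> \<open>A weight of at least 2 cannot be the default value 1.\<close>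
  then have "xs ! j \<in> set ys"
    by (auto simp: list_weight_def split: if_splits)
  then obtain j' where j': "j' < length ys" "xs ! j = ys ! j'"
    by (auto simp: in_set_conv_nth)
  then show "xs ! j = ys ! j"
    using w list_weight_nth[OF assms(2) j'(1)] by simp
qed (rule assms)

lemma threshold_rigid_cong:
  assumes "\<And>i. i \<in> S \<Longrightarrow> u i = v i"
  shows "threshold_rigid S u k \<longleftrightarrow> threshold_rigid S v k"
proof -
  have "sum u A = sum v A" if "A \<subseteq> S" for A
    using assms that by (intro sum.cong) auto
  then show ?thesis
    unfolding threshold_rigid_def using assms by simp
qed

lemma exists_admissible:
  fixes z :: "'n::finite"
  assumes xs: "distinct xs" "set xs \<subseteq> - {z}" "length xs + 4 = CARD('n)"
  shows "\<exists>k. admissible z ((list_weight xs)(z := k)) k"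
proof -
  let ?w = "list_weight xs"
  have "card (- {z} - set xs) = 3"
    using xs by (simp add: card_Diff_subset distinct_card Compl_eq_Diff_UNIV)
  then obtain a b c where abc: "- {z} - set xs = {a, b, c}" "distinct [a, b, c]"
    by (auto simp: card_3_iff)
  have "{a, b, c} \<union> set xs = - {z}" "set xs \<inter> {a, b, c} = {}"
    using abc(1) xs(2) by blast+
  moreover have "?w a = 1" "?w b = 1" "?w c = 1"
    using \<open>set xs \<inter> {a, b, c} = {}\<close> by (auto simp: list_weight_def)
  ultimately obtain k where k: "2 \<le> k" "k \<le> sum ?w (- {z})" "\<forall>i\<in>- {z}. ?w i \<le> k"
      "threshold_rigid (- {z}) ?w k"
    and sub: "\<forall>s\<le>sum ?w (- {z}). \<exists>B\<subseteq>- {z}. sum ?w B = s"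
    using exists_rigid_threshold[of a b c ?w xs] abc(2) xs(1) list_weight_nth[OF xs(1)] by auto
  let ?u = "?w(z := k)"
  have sums: "sum ?u A = sum ?w A" if "A \<subseteq> - {z}" for A
    using that by (intro sum.cong) auto
  obtain A0 where "A0 \<subseteq> - {z}" "sum ?w A0 = k"
    using sub k(2) by blast
  then have "\<exists>A0\<subseteq>- {z}. sum ?u A0 = k"
    using sums by auto
  moreover have "threshold_rigid (- {z}) ?u k"
    using k(4) threshold_rigid_cong[of "- {z}" ?u ?w k] by simp
  moreover have "a \<noteq> z" "?u a = 1"
    using \<open>{a, b, c} \<union> set xs = - {z}\<close> \<open>?w a = 1\<close> by auto
  moreover have "1 \<le> ?w i" for i
    by (simp add: list_weight_def)
  ultimately have "admissible z ?u k"
    using k(1-3) sums[of "- {z}"] unfolding admissible_def by auto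
  then show ?thesis ..
qed

theorem theorem2:
  assumes "CARD('n::finite) \<ge> 4"
  shows "\<exists>\<P> :: (real^'n) set set.
           finite \<P> \<and>
           real (card \<P>) \<ge> 1 / fact 3 * fact (CARD('n) - 1) \<and>
           pairwise (\<lambda>P Q. \<not> normally_equivalent P Q) \<P> \<and>
           (\<forall>P\<in>\<P>. deformed_permutahedron P \<and> indecomposable P \<and>
              \<not> (\<exists>\<B>. matroid_bases \<B> \<and> normally_equivalent P (matroid_polytope \<B>)))"
proof -
  obtain z :: 'n where True
    by simp
  define X where "X = {xs. length xs = CARD('n) - 4 \<and> distinct xs \<and> set xs \<subseteq> - {z}}"
  have "\<forall>xs\<in>X. \<exists>k. admissible z ((list_weight xs)(z := k)) k"
    using exists_admissible[of _ z] assms by (auto simp: X_def)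
  then obtain k where k: "\<And>xs. xs \<in> X \<Longrightarrow> admissible z ((list_weight xs)(z := k xs)) (k xs)"
    by metis
  define P where "P xs = base_polytope (threshold_rank (k xs) ((list_weight xs)(z := k xs)))" for xs
  have inj: "xs = ys" if "xs \<in> X" "ys \<in> X" "normally_equivalent (P xs) (P ys)" for xs ys
  proof (rule list_weight_inject)
    fix i
    assume "i \<in> set xs"
    then have "i \<noteq> z"
      using \<open>xs \<in> X\<close> by (auto simp: X_def)
    then show "list_weight xs i = list_weight ys i"
      using admissible_normally_equivalent[OF k[OF \<open>xs \<in> X\<close>] k[OF \<open>ys \<in> X\<close>] that(3)[unfolded P_def], of i]
      by simp
  qed (use that in \<open>auto simp: X_def\<close>)
  \<comment> \<open>Equal polytopes are in particular normally equivalent.\<close>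
  then have "inj_on P X"
    by (auto simp: inj_on_def normally_equivalent_def)
  have cX: "card X = \<Prod>{4..CARD('n) - 1}"
  proof -
    have "card (- {z}) = CARD('n) - 1"
      by (simp add: Compl_eq_Diff_UNIV)
    \<comment> \<open>The number of lists is a falling product, and this is its smallest factor. For
      \<open>N = 4\<close> the product is empty and the only list is \<open>[]\<close>.\<close>
    moreover have "CARD('n) - 1 - (CARD('n) - 4) + 1 = 4"
      using assms by linarith
    ultimately show ?thesis
      unfolding X_def using card_lists_distinct_length_eq[of "- {z}" "CARD('n) - 4"] assms by simp
  qed
  have "finite X"
    unfolding X_def by (rule finite_subset[OF _ finite_lists_length_eq[of "- {z}" "CARD('n) - 4"]]) auto
  have "fact (CARD('n) - 1) = fact 3 * card X"
  proof -
    have "{1..CARD('n) - 1} = {1..3} \<union> {4..CARD('n) - 1}"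
      using assms by auto
    then have "\<Prod>{1..CARD('n) - 1} = \<Prod>{1..3} * \<Prod>{4..CARD('n) - 1}"
      using prod.union_disjoint[of "{1..3}" "{4..CARD('n) - 1}" id] by simp
    then show ?thesis
      unfolding cX fact_prod of_nat_id .
  qed
  then have "real (fact (CARD('n) - 1)) = real (fact 3) * real (card X)"
    by (simp only: of_nat_mult)
  then have "1 / fact 3 * fact (CARD('n) - 1) = real (card (P ` X))"
    unfolding card_image[OF \<open>inj_on P X\<close>] of_nat_fact by simp
  moreover have "pairwise (\<lambda>P Q. \<not> normally_equivalent P Q) (P ` X)"
    using inj by (auto simp: pairwise_def)
  moreover have "deformed_permutahedron (P xs) \<and> indecomposable (P xs) \<and>
      \<not> (\<exists>\<B>. matroid_bases \<B> \<and> normally_equivalent (P xs) (matroid_polytope \<B>))" if "xs \<in> X" for xs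
    using deformed_permutahedron_base_polytope[OF submodular_threshold_rank]
      admissible_indecomposable[OF k[OF that]] admissible_not_matroid[OF k[OF that]]
    unfolding P_def by blast
  ultimately show ?thesis
    using \<open>finite X\<close> by (intro exI[of _ "P ` X"]) auto
qed

end
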